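(* The scheme defined in the context preserves free-stream: if the physical flux is constant, $\bm f_m=\bm\alpha$ with the same constant $\bm\alpha\in\mathbb{R}^{3}$ at all volume and facet nodes of every element, and the numerical flux is $\bm f_m^*=\bm\alpha$ at all facet nodes, then for every element $m$ $$\tfrac12(M_m+K_m)^{-1}\chi(\xi_v)^TW\big[\nabla^r\chi(\xi_v)\cdot\hat{\bm f}_m^{r\,T}+\tilde\nabla^r\chi(\xi_v)\cdot\hat{\bm f}_m^T\big]+(M_m+K_m)^{-1}\sum_{f=1}^{N_f}\sum_{k=1}^{N_{fp}}\chi(\xi_{f,k})^TW_{f,k}\,[\hat{\bm n}^r\cdot\bm f_m^{C,r}]=\bm0^T,$$ that is, the scheme holds with $\frac{d}{dt}\hat{\bm u}_m(t)^T=\bm0^T$.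
   Context: Reference element and basis: $\Omega_r=[-1,1]^3$ with coordinates $\xi=(\xi_1,\xi_2,\xi_3)$, $p\ge1$, $N_p=(p+1)^3$, and $\chi(\xi)=[\chi_1(\xi),\dots,\chi_{N_p}(\xi)]$ (row vector) a basis of the tensor-product polynomials of degree at most $p$ in each variable. The domain is partitioned into finitely many elements $\Omega_m$, each the image of $\Omega_r$ under a time-independent, possibly non-affine, mapping $\Theta_m$ with $J_m=\det(\partial x/\partial\xi)>0$. The solution in element $m$ is $u_m=\chi\hat{\bm u}_m(t)^T$ with $\hat{\bm u}_m\in\mathbb{R}^{1\times N_p}$. Quadrature: volume nodes $\xi_{v,q}$, $q=1,\dots,N_{vp}$, with diagonal weight matrix $W$; facet nodes $\xi_{f,k}$ with weights $W_{f,k}>0$ on the faces $f=1,\dots,N_f$ of $\Omega_r$; $\hat{\bm n}^r$ is the outward reference unit normal (row vector). $\chi(\xi_v)$, $\chi_{\xi_j}(\xi_v)$ are the $N_{vp}\times N_p$ matrices of basis values and $\xi_j$-derivatives. $M=\chi(\xi_v)^TW\chi(\xi_v)$ is invertible and $\Pi=M^{-1}\chi(\xi_v)^TW$ is the discrete $L_2$ projection. Metric terms: $C_m(\xi)\in\mathbb{R}^{3\times3}$ is the discrete metric cofactor matrix computed in conservative curl form, $(C_m)_{ni}=-\hat e_i\cdot\nabla^r\times\mathcal I[x_l\nabla^r x_k]$ with $(n,k,l)$ cyclic, where $x_1,x_2,x_3$ are the components of the polynomial mapping and $\mathcal I$ is polynomial interpolation at the mapping (grid) nodes (or in the analogous invariant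 curl form, with $\tfrac12(x_l\nabla^rx_k-x_k\nabla^rx_l)$ in place of $x_l\nabla^r x_k$). Hence its entries are polynomials with $\sum_{i}\partial_{\xi_i}(C_m)_{ni}=0$ for $n=1,2,3$ (geometric conservation law), and they are reproduced by the projection: $\chi(\xi)\Pi[(C_m)_{ni}(\xi_{v,q})]_q=(C_m)_{ni}(\xi)$, in particular at the facet nodes. Norm: $M_m=\chi(\xi_v)^TWJ_m\chi(\xi_v)$, with $J_m$ the diagonal matrix of Jacobian determinants at volume nodes, and $$K_m=\sum_{(s,v,w)}c_{(s,v,w)}\,\partial^{(s,v,w)}\chi(\xi_v)^T\,WJ_m\,\partial^{(s,v,w)}\chi(\xi_v),$$ the sum over $s,v,w\in\{0,p\}$ with $s+v+w\ge p$, where $\partial^{(s,v,w)}=\partial^{s+v+w}/\partial\xi_1^s\partial\xi_2^v\partial\xi_3^w$ and $c_{(s,v,w)}=c_{1D}^{(s+v+w)/p}$. The parameter $c_{1D}$ is such that $M_m+K_m$ is symmetric positive definite. Fluxes: $\hat{\bm f}_{m,i}^T=\Pi\,[f_i(u_m(\xi_{v,q}))]_q$ are the coefficients of the $i$th physical flux component, and $\hat{\bm f}^{r\,T}_{m,j}=\Pi\,[\sum_i f_i(u_m(\xi_{v,q}))(C_m(\xi_{v,q}))_{ij}]_q$ those of the $j$th reference flux component. Write $\nabla^r\chi(\xi_v)\cdot\hat{\bm f}_m^{r\,T}=\sum_j\chi_{\xi_j}(\xi_v)\hat{\bm f}^{r\,T}_{m,j}$ and $\tilde\nabla^r\chi(\xi_v)\cdot\hat{\bm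 f}_m^T=\sum_{i,j}\mathrm{diag}_q\big((C_m(\xi_{v,q}))_{ij}\big)\chi_{\xi_j}(\xi_v)\hat{\bm f}_{m,i}^T$. At a facet node, $\bm f_m$ is the physical flux, $\bm f_m^*$ is the numerical flux, and $\bm f_m^{C,r}=\bm f_m^*C_m(\xi_{f,k})-\tfrac12\bm f_mC_m(\xi_{f,k})-\tfrac12\chi(\xi_{f,k})\hat{\bm f}_m^{r\,T}$. Scheme: for every element $m$, $$\frac{d\hat{\bm u}_m^T}{dt}+\tfrac12(M_m+K_m)^{-1}\chi(\xi_v)^TW\big[\nabla^r\chi(\xi_v)\cdot\hat{\bm f}_m^{r\,T}+\tilde\nabla^r\chi(\xi_v)\cdot\hat{\bm f}_m^T\big]+(M_m+K_m)^{-1}\sum_{f,k}\chi(\xi_{f,k})^TW_{f,k}\,[\hat{\bm n}^r\cdot\bm f_m^{C,r}]=\bm0^T .$$ *)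

theory Defs
  imports "HOL-Analysis.Analysis"
begin

section \<open>Differential operators in reference coordinates\<close>

definition partial :: "3 \<Rightarrow> (real^3 \<Rightarrow> real) \<Rightarrow> real^3 \<Rightarrow> real" where
  "partial j g \<xi> = frechet_derivative g (at \<xi>) (axis j 1)"

definition mixed_partial :: "nat \<Rightarrow> nat \<Rightarrow> nat \<Rightarrow> (real^3 \<Rightarrow> real) \<Rightarrow> real^3 \<Rightarrow> real" where
  "mixed_partial s v w = (partial 1 ^^ s) \<circ> (partial 2 ^^ v) \<circ> (partial 3 ^^ w)"

definition grad :: "(real^3 \<Rightarrow> real) \<Rightarrow> real^3 \<Rightarrow> real^3" where
  "grad g \<xi> = (\<chi> j. partial j g \<xi>)"

definition curl :: "(real^3 \<Rightarrow> real^3) \<Rightarrow> real^3 \<Rightarrow> real^3" where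
  "curl F \<xi> = vector
     [partial 2 (\<lambda>\<zeta>. F \<zeta> $ 3) \<xi> - partial 3 (\<lambda>\<zeta>. F \<zeta> $ 2) \<xi>,
      partial 3 (\<lambda>\<zeta>. F \<zeta> $ 1) \<xi> - partial 1 (\<lambda>\<zeta>. F \<zeta> $ 3) \<xi>,
      partial 1 (\<lambda>\<zeta>. F \<zeta> $ 2) \<xi> - partial 2 (\<lambda>\<zeta>. F \<zeta> $ 1) \<xi>]"

section \<open>Reference element\<close>

definition ref_cube :: "(real^3) set" where
  "ref_cube = {\<xi>. \<forall>i. \<xi> $ i \<in> {-1..1}}"

text \<open>The face \<open>(j, b)\<close> of the cube is \<open>\<xi> $ j = 1\<close> if \<open>b\<close> holds and \<open>\<xi> $ j = -1\<close> otherwise.\<close>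

type_synonym face = "3 \<times> bool"

definition face_sign :: "face \<Rightarrow> real" where
  "face_sign \<phi> = (if snd \<phi> then 1 else -1)"

definition face_set :: "face \<Rightarrow> (real^3) set" where
  "face_set \<phi> = {\<xi> \<in> ref_cube. \<xi> $ fst \<phi> = face_sign \<phi>}"

definition face_normal :: "face \<Rightarrow> real^3" where
  "face_normal \<phi> = axis (fst \<phi>) (face_sign \<phi>)"

definition tensor_poly :: "nat \<Rightarrow> (real^3 \<Rightarrow> real) set" where
  "tensor_poly n = {g. \<exists>c. g = (\<lambda>\<xi>. \<Sum>a\<le>n. \<Sum>b\<le>n. \<Sum>d\<le>n.
     c a b d * (\<xi> $ 1) ^ a * (\<xi> $ 2) ^ b * (\<xi> $ 3) ^ d)}"

record ('b, 'q, 'k) reference_data =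
  degr :: nat
  shape :: "'b \<Rightarrow> real^3 \<Rightarrow> real"
  vnode :: "'q \<Rightarrow> real^3"
  vweight :: "'q \<Rightarrow> real"
  fnode :: "face \<Rightarrow> 'k \<Rightarrow> real^3"
  fweight :: "face \<Rightarrow> 'k \<Rightarrow> real"
  c1D :: real

definition expand :: "('b::finite, 'q, 'k) reference_data \<Rightarrow> real^'b \<Rightarrow> real^3 \<Rightarrow> real" where
  "expand D c \<xi> = (\<Sum>i\<in>UNIV. shape D i \<xi> * c $ i)"

definition is_tensor_basis :: "('b::finite, 'q, 'k) reference_data \<Rightarrow> bool" where
  "is_tensor_basis D \<longleftrightarrow>
     (\<forall>i. shape D i \<in> tensor_poly (degr D)) \<and>
     (\<forall>g \<in> tensor_poly (degr D). \<exists>!c. g = expand D c)"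

definition reference_element :: "('b::finite, 'q::finite, 'k::finite) reference_data \<Rightarrow> bool" where
  "reference_element D \<longleftrightarrow>
     degr D \<ge> 1 \<and>
     CARD('b) = (degr D + 1) ^ 3 \<and>
     is_tensor_basis D \<and>
     (\<forall>q. vnode D q \<in> ref_cube) \<and>
     (\<forall>\<phi> k. fnode D \<phi> k \<in> face_set \<phi>) \<and>
     (\<forall>\<phi> k. fweight D \<phi> k > 0)"

definition diag :: "('q::finite \<Rightarrow> real) \<Rightarrow> real^'q^'q" where
  "diag d = (\<chi> q r. if q = r then d q else 0)"

definition vol_mat ::
  "('b::finite, 'q::finite, 'k) reference_data \<Rightarrow> ((real^3 \<Rightarrow> real) \<Rightarrow> real^3 \<Rightarrow> real) \<Rightarrow> real^'b^'q" where
  "vol_mat D L = (\<chi> q i. L (shape D i) (vnode D q))"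

abbreviation vandermonde :: "('b::finite, 'q::finite, 'k) reference_data \<Rightarrow> real^'b^'q" where
  "vandermonde D \<equiv> vol_mat D (\<lambda>g. g)"

definition ref_mass :: "('b::finite, 'q::finite, 'k) reference_data \<Rightarrow> real^'b^'b" where
  "ref_mass D = transpose (vandermonde D) ** diag (vweight D) ** vandermonde D"

definition L2_proj :: "('b::finite, 'q::finite, 'k) reference_data \<Rightarrow> real^'q^'b" where
  "L2_proj D = matrix_inv (ref_mass D) ** transpose (vandermonde D) ** diag (vweight D)"

section \<open>Curvilinear elements and discrete metric terms\<close>

record element =
  mapping :: "real^3 \<Rightarrow> real^3"
  grid_degr :: nat
  grid_nodes :: "(real^3) set"

definition unisolvent :: "nat \<Rightarrow> (real^3) set \<Rightarrow> bool" where
  "unisolvent n G \<longleftrightarrow> (\<forall>h. \<exists>!g. g \<in> tensor_poly n \<and> (\<forall>\<zeta>\<in>G. g \<zeta> = h \<zeta>))"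

definition interp :: "element \<Rightarrow> (real^3 \<Rightarrow> real) \<Rightarrow> real^3 \<Rightarrow> real" where
  "interp E h = (THE g. g \<in> tensor_poly (grid_degr E) \<and> (\<forall>\<zeta>\<in>grid_nodes E. g \<zeta> = h \<zeta>))"

definition interp_vec :: "element \<Rightarrow> (real^3 \<Rightarrow> real^3) \<Rightarrow> real^3 \<Rightarrow> real^3" where
  "interp_vec E F \<xi> = (\<chi> j. interp E (\<lambda>\<zeta>. F \<zeta> $ j) \<xi>)"

definition jac_det :: "element \<Rightarrow> real^3 \<Rightarrow> real" where
  "jac_det E \<xi> = det (jacobian (mapping E) (at \<xi>))"

definition polynomial_element :: "element \<Rightarrow> bool" where
  "polynomial_element E \<longleftrightarrow>
     grid_nodes E \<subseteq> ref_cube \<and>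
     unisolvent (grid_degr E) (grid_nodes E) \<and>
     (\<forall>n. (\<lambda>\<xi>. mapping E \<xi> $ n) \<in> tensor_poly (grid_degr E)) \<and>
     (\<forall>\<xi>\<in>ref_cube. jac_det E \<xi> > 0)"

text \<open>Closed elements that share a face intersect, so only their interiors are disjoint.\<close>

definition curvilinear_mesh :: "(real^3) set \<Rightarrow> ('m::finite \<Rightarrow> element) \<Rightarrow> bool" where
  "curvilinear_mesh \<Omega> E \<longleftrightarrow>
     (\<forall>m. polynomial_element (E m)) \<and>
     \<Omega> = (\<Union>m. mapping (E m) ` ref_cube) \<and>
     (\<forall>m m'. m \<noteq> m' \<longrightarrow>
        interior (mapping (E m) ` ref_cube) \<inter> interior (mapping (E m') ` ref_cube) = {})"

datatype curl_form = Conservative | Invariant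

definition curl_integrand :: "curl_form \<Rightarrow> (real^3 \<Rightarrow> real^3) \<Rightarrow> 3 \<Rightarrow> 3 \<Rightarrow> real^3 \<Rightarrow> real^3" where
  "curl_integrand form x k l \<zeta> = (case form of
     Conservative \<Rightarrow> x \<zeta> $ l *\<^sub>R grad (\<lambda>\<xi>. x \<xi> $ k) \<zeta>
   | Invariant \<Rightarrow> (1/2) *\<^sub>R (x \<zeta> $ l *\<^sub>R grad (\<lambda>\<xi>. x \<xi> $ k) \<zeta> -
                            x \<zeta> $ k *\<^sub>R grad (\<lambda>\<xi>. x \<xi> $ l) \<zeta>))"

text \<open>Arithmetic in the index type \<open>3\<close> is modulo 3, so \<open>(n, n + 1, n + 2)\<close> is cyclic.\<close>

definition cofactor :: "curl_form \<Rightarrow> element \<Rightarrow> real^3 \<Rightarrow> real^3^3" where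
  "cofactor form E \<xi> =
     (\<chi> n i. - curl (interp_vec E (curl_integrand form (mapping E) (n + 1) (n + 2))) \<xi> $ i)"

definition metrics_reproduced ::
  "('b::finite, 'q::finite, 'k) reference_data \<Rightarrow> curl_form \<Rightarrow> element \<Rightarrow> bool" where
  "metrics_reproduced D form E \<longleftrightarrow> (\<forall>n i. \<forall>\<xi>\<in>ref_cube.
     expand D (L2_proj D *v (\<chi> q. cofactor form E (vnode D q) $ n $ i)) \<xi>
       = cofactor form E \<xi> $ n $ i)"

section \<open>Norm\<close>

definition weight_jac ::
  "('b, 'q::finite, 'k) reference_data \<Rightarrow> element \<Rightarrow> real^'q^'q" where
  "weight_jac D E = diag (vweight D) ** diag (\<lambda>q. jac_det E (vnode D q))"

definition phys_mass ::
  "('b::finite, 'q::finite, 'k) reference_data \<Rightarrow> element \<Rightarrow> real^'b^'b" where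
  "phys_mass D E = transpose (vandermonde D) ** weight_jac D E ** vandermonde D"

text \<open>Every index triple sums to a multiple of \<open>p\<close>, so the division in the exponent is exact.\<close>

definition K_mat ::
  "('b::finite, 'q::finite, 'k) reference_data \<Rightarrow> element \<Rightarrow> real^'b^'b" where
  "K_mat D E = (let p = degr D in
     \<Sum>(s, v, w) \<in> {(s, v, w). s \<in> {0, p} \<and> v \<in> {0, p} \<and> w \<in> {0, p} \<and> s + v + w \<ge> p}.
       c1D D ^ ((s + v + w) div p) *\<^sub>R
         (transpose (vol_mat D (mixed_partial s v w)) ** weight_jac D E
            ** vol_mat D (mixed_partial s v w)))"

definition norm_mat ::
  "('b::finite, 'q::finite, 'k) reference_data \<Rightarrow> element \<Rightarrow> real^'b^'b" where
  "norm_mat D E = phys_mass D E + K_mat D E"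

definition sym_pos_def :: "real^'n^'n \<Rightarrow> bool" where
  "sym_pos_def A \<longleftrightarrow> transpose A = A \<and> (\<forall>x. x \<noteq> 0 \<longrightarrow> x \<bullet> (A *v x) > 0)"

section \<open>Split-form scheme\<close>

definition flux_coef ::
  "('b::finite, 'q::finite, 'k) reference_data \<Rightarrow> (real \<Rightarrow> real^3) \<Rightarrow> real^'b \<Rightarrow> 3 \<Rightarrow> real^'b" where
  "flux_coef D f u i = L2_proj D *v (\<chi> q. f (expand D u (vnode D q)) $ i)"

definition ref_flux_coef ::
  "('b::finite, 'q::finite, 'k) reference_data \<Rightarrow> curl_form \<Rightarrow> element \<Rightarrow>
     (real \<Rightarrow> real^3) \<Rightarrow> real^'b \<Rightarrow> 3 \<Rightarrow> real^'b" where
  "ref_flux_coef D form E f u j = L2_proj D *v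
     (\<chi> q. \<Sum>i\<in>UNIV. f (expand D u (vnode D q)) $ i * cofactor form E (vnode D q) $ i $ j)"

definition ref_div ::
  "('b::finite, 'q::finite, 'k) reference_data \<Rightarrow> curl_form \<Rightarrow> element \<Rightarrow>
     (real \<Rightarrow> real^3) \<Rightarrow> real^'b \<Rightarrow> real^'q" where
  "ref_div D form E f u = (\<Sum>j\<in>UNIV. vol_mat D (partial j) *v ref_flux_coef D form E f u j)"

definition phys_div ::
  "('b::finite, 'q::finite, 'k) reference_data \<Rightarrow> curl_form \<Rightarrow> element \<Rightarrow>
     (real \<Rightarrow> real^3) \<Rightarrow> real^'b \<Rightarrow> real^'q" where
  "phys_div D form E f u = (\<Sum>i\<in>UNIV. \<Sum>j\<in>UNIV.
     diag (\<lambda>q. cofactor form E (vnode D q) $ i $ j) *v (vol_mat D (partial j) *v flux_coef D f u i))"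

definition volume_term ::
  "('b::finite, 'q::finite, 'k) reference_data \<Rightarrow> curl_form \<Rightarrow> element \<Rightarrow>
     (real \<Rightarrow> real^3) \<Rightarrow> real^'b \<Rightarrow> real^'b" where
  "volume_term D form E f u = (1/2) *\<^sub>R
     ((matrix_inv (norm_mat D E) ** transpose (vandermonde D) ** diag (vweight D)) *v
        (ref_div D form E f u + phys_div D form E f u))"

text \<open>\<open>fs \<phi> k\<close> is the numerical flux at the facet node \<open>k\<close> of the face \<open>\<phi>\<close>.\<close>

definition corr_flux ::
  "('b::finite, 'q::finite, 'k) reference_data \<Rightarrow> curl_form \<Rightarrow> element \<Rightarrow>
     (real \<Rightarrow> real^3) \<Rightarrow> real^'b \<Rightarrow> (face \<Rightarrow> 'k \<Rightarrow> real^3) \<Rightarrow> face \<Rightarrow> 'k \<Rightarrow> real^3" where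
  "corr_flux D form E f u fs \<phi> k = (let \<xi> = fnode D \<phi> k in
     fs \<phi> k v* cofactor form E \<xi>
     - (1/2) *\<^sub>R (f (expand D u \<xi>) v* cofactor form E \<xi>)
     - (1/2) *\<^sub>R (\<chi> j. expand D (ref_flux_coef D form E f u j) \<xi>))"

definition surface_term ::
  "('b::finite, 'q::finite, 'k::finite) reference_data \<Rightarrow> curl_form \<Rightarrow> element \<Rightarrow>
     (real \<Rightarrow> real^3) \<Rightarrow> real^'b \<Rightarrow> (face \<Rightarrow> 'k \<Rightarrow> real^3) \<Rightarrow> real^'b" where
  "surface_term D form E f u fs = matrix_inv (norm_mat D E) *v
     (\<Sum>\<phi>\<in>UNIV. \<Sum>k\<in>UNIV.
        (fweight D \<phi> k * (face_normal \<phi> \<bullet> corr_flux D form E f u fs \<phi> k))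
          *\<^sub>R (\<chi> i. shape D i (fnode D \<phi> k)))"

definition scheme_at ::
  "('b::finite, 'q::finite, 'k::finite) reference_data \<Rightarrow> curl_form \<Rightarrow> element \<Rightarrow>
     (real \<Rightarrow> real^3) \<Rightarrow> (real \<Rightarrow> real^'b) \<Rightarrow> (real \<Rightarrow> face \<Rightarrow> 'k \<Rightarrow> real^3) \<Rightarrow> real \<Rightarrow> bool" where
  "scheme_at D form E f u fs t \<longleftrightarrow> (\<exists>du. (u has_vector_derivative du) (at t) \<and>
     du + volume_term D form E f (u t) + surface_term D form E f (u t) (fs t) = 0)"

section \<open>When the metric terms are reproduced\<close>

text \<open>The grid degree is independent of the solution degree, so \<open>metrics_reproduced\<close> is a genuine condition.
  It is automatic for subparametric and isoparametric elements
  (\<open>metrics_reproduced_if_grid_degr_le\<close>). The geometric conservation law is a consequence of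
  the curl form and is not assumed.\<close>

definition monom3 :: "nat \<Rightarrow> nat \<Rightarrow> nat \<Rightarrow> real^3 \<Rightarrow> real" where
  "monom3 a b d \<xi> = (\<xi> $ 1) ^ a * (\<xi> $ 2) ^ b * (\<xi> $ 3) ^ d"

lemma tensor_poly_iff: "g \<in> tensor_poly n \<longleftrightarrow> (\<exists>c. g = (\<lambda>\<xi>. \<Sum>a\<le>n. \<Sum>b\<le>n. \<Sum>d\<le>n. c a b d * monom3 a b d \<xi>))"
  by (simp add: tensor_poly_def monom3_def mult.assoc)

lemma tensor_poly_scale: assumes "g \<in> tensor_poly n" shows "(\<lambda>\<xi>. r * g \<xi>) \<in> tensor_poly n"
proof -
  from assms obtain c where "g = (\<lambda>\<xi>. \<Sum>a\<le>n. \<Sum>b\<le>n. \<Sum>d\<le>n. c a b d * monom3 a b d \<xi>)"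
    by (auto simp: tensor_poly_iff)
  then show ?thesis unfolding tensor_poly_iff
    by (intro exI[of _ "\<lambda>a b d. r * c a b d"]) (simp add: sum_distrib_left mult.assoc)
qed

lemma tensor_poly_add: assumes "g \<in> tensor_poly n" "h \<in> tensor_poly n" shows "(\<lambda>\<xi>. g \<xi> + h \<xi>) \<in> tensor_poly n"
proof -
  from assms obtain c e where "g = (\<lambda>\<xi>. \<Sum>a\<le>n. \<Sum>b\<le>n. \<Sum>d\<le>n. c a b d * monom3 a b d \<xi>)"
     "h = (\<lambda>\<xi>. \<Sum>a\<le>n. \<Sum>b\<le>n. \<Sum>d\<le>n. e a b d * monom3 a b d \<xi>)"
    by (auto simp: tensor_poly_iff)
  then show ?thesis unfolding tensor_poly_iff
    by (intro exI[of _ "\<lambda>a b d. c a b d + e a b d"]) (simp add: sum.distrib algebra_simps)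
qed

lemma tensor_poly_zero: "(\<lambda>\<xi>. 0) \<in> tensor_poly n"
  unfolding tensor_poly_iff by (intro exI[of _ "\<lambda>a b d. 0"]) simp

lemma tensor_poly_sum: "finite A \<Longrightarrow> (\<And>x. x \<in> A \<Longrightarrow> g x \<in> tensor_poly n) \<Longrightarrow> (\<lambda>\<xi>. \<Sum>x\<in>A. g x \<xi>) \<in> tensor_poly n"
  by (induction A rule: finite_induct) (auto simp: tensor_poly_zero tensor_poly_add)

lemma tensor_poly_monom3: assumes "a \<le> n" "b \<le> n" "d \<le> n" shows "monom3 a b d \<in> tensor_poly n"
proof -
  have *: "(if i = a \<and> j = b \<and> k = d then 1 else 0) * monom3 i j k \<xi> =
    (if k = d then (if j = b then (if i = a then monom3 a b d \<xi> else 0) else 0) else 0)" for i j k \<xi>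
    by auto
  have "monom3 a b d \<xi> = (\<Sum>i\<le>n. \<Sum>j\<le>n. \<Sum>k\<le>n. (if i = a \<and> j = b \<and> k = d then 1 else 0) * monom3 i j k \<xi>)" for \<xi>
    unfolding * using assms by (simp add: sum.delta)
  then show ?thesis unfolding tensor_poly_iff
    by (intro exI[of _ "\<lambda>i j k. if i = a \<and> j = b \<and> k = d then 1 else 0"] ext)
qed

lemma tensor_poly_degree_mono: assumes "g \<in> tensor_poly n" "n \<le> m" shows "g \<in> tensor_poly m"
proof -
  from assms obtain c where g: "g = (\<lambda>\<xi>. \<Sum>a\<le>n. \<Sum>b\<le>n. \<Sum>d\<le>n. c a b d * monom3 a b d \<xi>)"
    by (auto simp: tensor_poly_iff)
  show ?thesis unfolding g
    by (intro tensor_poly_sum tensor_poly_scale tensor_poly_monom3) (use assms in auto)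
qed

lemma monom3_has_derivative: "(monom3 a b d has_derivative (\<lambda>h. 
    real a * monom3 (a-1) b d \<xi> * h $ 1 + real b * monom3 a (b-1) d \<xi> * h $ 2 + real d * monom3 a b (d-1) \<xi> * h $ 3)) (at \<xi>)"
proof -
  have "((\<lambda>\<xi>::real^3. (\<xi> $ 1) ^ a * (\<xi> $ 2) ^ b * (\<xi> $ 3) ^ d) has_derivative (\<lambda>h. 
    real a * monom3 (a-1) b d \<xi> * h $ 1 + real b * monom3 a (b-1) d \<xi> * h $ 2 + real d * monom3 a b (d-1) \<xi> * h $ 3)) (at \<xi>)"
    unfolding monom3_def
    by (rule has_derivative_eq_rhs, (rule derivative_intros bounded_linear.has_derivative[OF bounded_linear_vec_nth])+)
      (auto simp: fun_eq_iff algebra_simps)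
  then show ?thesis by (simp add: monom3_def[abs_def])
qed

lemma tensor_poly_has_derivative:
  assumes "g \<in> tensor_poly n"
  shows "\<exists>g'. (\<forall>j. g' j \<in> tensor_poly n) \<and> (\<forall>\<xi>. (g has_derivative (\<lambda>h. \<Sum>j\<in>UNIV. g' j \<xi> * h $ j)) (at \<xi>))"
proof -
  from assms obtain c where g: "g = (\<lambda>\<xi>. \<Sum>a\<le>n. \<Sum>b\<le>n. \<Sum>d\<le>n. c a b d * monom3 a b d \<xi>)"
    by (auto simp: tensor_poly_iff)
  define mm where "mm j a b d \<xi> = (if j = (1::3) then real a * monom3 (a-1) b d \<xi> else if j = 2 then real b * monom3 a (b-1) d \<xi> else real d * monom3 a b (d-1) \<xi>)" for j a b d \<xi>
  define g' where "g' j \<xi> = (\<Sum>a\<le>n. \<Sum>b\<le>n. \<Sum>d\<le>n. c a b d * mm j a b d \<xi>)" for j \<xi>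
  have 1: "g' j \<in> tensor_poly n" for j
  proof -
    have "(\<lambda>\<xi>. mm j a b d \<xi>) \<in> tensor_poly n" if "a \<le> n" "b \<le> n" "d \<le> n" for a b d
      unfolding mm_def using that by (cases "j = 1"; cases "j = 2") (auto intro!: tensor_poly_scale tensor_poly_monom3)
    then show ?thesis unfolding g'_def[abs_def] by (intro tensor_poly_sum tensor_poly_scale) auto
  qed
  have 2: "(g has_derivative (\<lambda>h. \<Sum>j\<in>UNIV. g' j \<xi> * h $ j)) (at \<xi>)" for \<xi>
    unfolding g
    apply (rule has_derivative_eq_rhs)
    apply (rule has_derivative_sum has_derivative_mult_right monom3_has_derivative)+
    apply (simp add: fun_eq_iff g'_def mm_def sum_distrib_left sum_distrib_right sum.distrib sum_3 algebra_simps)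
    done
  from 1 2 show ?thesis by blast
qed

lemma tensor_poly_partial: assumes "g \<in> tensor_poly n" shows "partial j g \<in> tensor_poly n"
proof -
  obtain g' where g': "\<And>j. g' j \<in> tensor_poly n" "\<And>\<xi>. (g has_derivative (\<lambda>h. \<Sum>j\<in>UNIV. g' j \<xi> * h $ j)) (at \<xi>)"
    using tensor_poly_has_derivative[OF assms] by blast
  have "partial j g \<xi> = g' j \<xi>" for \<xi>
  proof -
    have "frechet_derivative g (at \<xi>) = (\<lambda>h. \<Sum>j\<in>UNIV. g' j \<xi> * h $ j)"
      using frechet_derivative_at[OF g'(2)] by simp
    then show ?thesis by (simp add: partial_def axis_def if_distrib cong: if_cong)
  qed
  then have "partial j g = g' j" by auto
  then show ?thesis using g' by simp
qed

lemma interp_in_tensor_poly: assumes "unisolvent (grid_degr E) (grid_nodes E)"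
  shows "interp E h \<in> tensor_poly (grid_degr E)"
  using theI'[OF assms[unfolded unisolvent_def, rule_format, of h]] unfolding interp_def by blast

lemma cofactor_in_tensor_poly:
  assumes "unisolvent (grid_degr E) (grid_nodes E)"
  shows "(\<lambda>\<xi>. cofactor form E \<xi> $ n $ i) \<in> tensor_poly (grid_degr E)"
proof -
  note p = tensor_poly_partial[OF interp_in_tensor_poly[OF assms]]
  have s: "(\<lambda>\<xi>. - (partial j (interp E g) \<xi> - partial k (interp E h) \<xi>)) \<in> tensor_poly (grid_degr E)" for j k g h
    using tensor_poly_add[OF tensor_poly_scale[OF p, of "-1"] p, of j g k h] by (simp add: algebra_simps)
  have "i = 1 \<or> i = 2 \<or> i = 3" using exhaust_3 by blast
  then show ?thesis
    by (auto simp: cofactor_def curl_def interp_vec_def vector_3 s simp del: minus_diff_eq)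
qed

lemma L2_proj_reproduces:
  assumes inv: "invertible (ref_mass D)" and "is_tensor_basis D" and "g \<in> tensor_poly (degr D)"
  shows "expand D (L2_proj D *v (\<chi> q. g (vnode D q))) = g"
proof -
  obtain c where c: "g = expand D c" using assms unfolding is_tensor_basis_def by blast
  have "(\<chi> q. g (vnode D q)) = vandermonde D *v c"
    by (simp add: c expand_def vol_mat_def matrix_vector_mult_def)
  moreover have "L2_proj D *v (vandermonde D *v c) = c"
  proof -
    have "L2_proj D ** vandermonde D = matrix_inv (ref_mass D) ** ref_mass D"
      by (simp add: L2_proj_def ref_mass_def matrix_mul_assoc)
    also have "\<dots> = mat 1"
      using inv unfolding invertible_def matrix_inv_def by (rule someI2_ex) auto
    finally show ?thesis by (simp add: matrix_vector_mul_assoc)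
  qed
  ultimately show ?thesis by (simp add: c)
qed

lemma metrics_reproduced_if_grid_degr_le:
  assumes "is_tensor_basis D" and "invertible (ref_mass D)"
    and "polynomial_element E" and "grid_degr E \<le> degr D"
  shows "metrics_reproduced D form E"
proof -
  have "(\<lambda>\<xi>. cofactor form E \<xi> $ n $ i) \<in> tensor_poly (degr D)" for n i
    using cofactor_in_tensor_poly tensor_poly_degree_mono assms unfolding polynomial_element_def by blast
  from L2_proj_reproduces[OF assms(2,1) this] show ?thesis
    unfolding metrics_reproduced_def fun_eq_iff by blast
qed

end

theory Submission
  imports Defs
begin

text \<open>
  With constant flux \<open>\<alpha>\<close> every numerical contribution reduces to an exact identity for polynomials.

  The projection reproduces the constants \<open>\<alpha> $ i\<close>, so the physical flux coefficients represent
  constant functions and the nonconservative half of the volume term is a sum of their derivatives,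
  which vanish (\<open>phys_div_constant_flux\<close>). It also reproduces the metric terms, hence the \<open>j\<close>-th
  reference flux is the polynomial \<open>\<Sum>i. \<alpha> $ i * C $ i $ j\<close> itself
  (\<open>expand_ref_flux_coef_constant\<close>). This has two consequences. At the facet nodes the interpolated and
  the pointwise reference fluxes agree, so the correction flux is \<open>(1 - 1/2 - 1/2) \<alpha> C = 0\<close>
  (\<open>corr_flux_constant_flux\<close>). In the volume, the conservative half is the combination
  with weights \<open>\<alpha> $ i\<close> of the divergences of the rows of \<open>C\<close>; each row is minus the curl
  of a polynomial field, so its divergence is zero (\<open>cofactor_divergence_free\<close>).

  Aliasing and quadrature errors never enter: both halves of the volume term vanish at every volume
  node, and the correction flux at every facet node, before anything is tested against the basis.

  Reproduction of the metric terms is known on the closed cube only, and volume nodes may lie on its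
  boundary. The partial derivatives nevertheless carry over, because a derivative within
  a nondegenerate box is unique also at boundary points (\<open>partial_eq_if_eq_on_ref_cube\<close>).
\<close>

section \<open>Calculus of tensor-product polynomials\<close>

lemma partial_eqI:
  assumes "(g has_derivative g') (at \<xi>)"
  shows "partial j g \<xi> = g' (axis j 1)"
  using frechet_derivative_at[OF assms] by (simp add: partial_def)

lemma tensor_poly_differentiable:
  assumes "g \<in> tensor_poly n"
  shows "g differentiable (at \<xi>)"
  using tensor_poly_has_derivative[OF assms] unfolding differentiable_def by blast

lemma partial_scale:
  assumes "g differentiable (at \<xi>)"
  shows "partial j (\<lambda>\<zeta>. r * g \<zeta>) \<xi> = r * partial j g \<xi>"
  using assms
  by (auto simp: partial_def frechet_derivative_works
      intro!: partial_eqI[unfolded partial_def] has_derivative_mult_right)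

lemma partial_sum:
  assumes "\<And>x. x \<in> A \<Longrightarrow> g x differentiable (at \<xi>)"
  shows "partial j (\<lambda>\<zeta>. \<Sum>x\<in>A. g x \<zeta>) \<xi> = (\<Sum>x\<in>A. partial j (g x) \<xi>)"
  using assms
  by (auto simp: partial_def frechet_derivative_works
      intro!: partial_eqI[unfolded partial_def] has_derivative_sum)

lemma partial_diff:
  assumes "g differentiable (at \<xi>)" "h differentiable (at \<xi>)"
  shows "partial j (\<lambda>\<zeta>. g \<zeta> - h \<zeta>) \<xi> = partial j g \<xi> - partial j h \<xi>"
  using assms
  by (auto simp: partial_def frechet_derivative_works
      intro!: partial_eqI[unfolded partial_def] has_derivative_diff)

lemma partial_const: "partial j (\<lambda>\<zeta>. r) \<xi> = 0"
  by (subst partial_eqI[OF has_derivative_const]) simp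

lemma partial_monom3:
  "partial j (monom3 a b d) = (\<lambda>\<xi>.
     if j = 1 then real a * monom3 (a - 1) b d \<xi>
     else if j = 2 then real b * monom3 a (b - 1) d \<xi>
     else real d * monom3 a b (d - 1) \<xi>)"
proof
  fix \<xi> :: "real^3"
  have "j = 1 \<or> j = 2 \<or> j = 3"
    using exhaust_3 by blast
  then show "partial j (monom3 a b d) \<xi> = (if j = 1 then real a * monom3 (a - 1) b d \<xi>
     else if j = 2 then real b * monom3 a (b - 1) d \<xi>
     else real d * monom3 a b (d - 1) \<xi>)"
    by (subst partial_eqI[OF monom3_has_derivative]) (auto simp: axis_def)
qed

lemma monom3_differentiable: "monom3 a b d differentiable (at \<xi>)"
  using monom3_has_derivative unfolding differentiable_def by blast

lemma partial_commute_monom3: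
  "partial j (partial k (monom3 a b d)) \<xi> = partial k (partial j (monom3 a b d)) \<xi>"
  using exhaust_3[of j] exhaust_3[of k]
  by (auto simp: partial_monom3 partial_scale monom3_differentiable)

lemma tensor_poly_partial_commute:
  assumes "g \<in> tensor_poly n"
  shows "partial j (partial k g) \<xi> = partial k (partial j g) \<xi>"
proof -
  obtain c where g: "g = (\<lambda>\<xi>. \<Sum>a\<le>n. \<Sum>b\<le>n. \<Sum>d\<le>n. c a b d * monom3 a b d \<xi>)"
    using assms by (auto simp: tensor_poly_iff)
  have 1: "partial i g = (\<lambda>\<xi>. \<Sum>a\<le>n. \<Sum>b\<le>n. \<Sum>d\<le>n. c a b d * partial i (monom3 a b d) \<xi>)" for i
    unfolding g
    by (rule ext) (simp add: partial_sum partial_scale monom3_differentiable)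
  have d: "partial i (monom3 a b d) differentiable (at \<zeta>)" for i a b d \<zeta>
    by (rule tensor_poly_differentiable[OF tensor_poly_partial[OF tensor_poly_monom3[of a "max a (max b d)" b d]]]) auto
  have 2: "partial i (partial i' g) \<xi>
      = (\<Sum>a\<le>n. \<Sum>b\<le>n. \<Sum>d\<le>n. c a b d * partial i (partial i' (monom3 a b d)) \<xi>)" for i i'
    unfolding 1 by (simp add: partial_sum partial_scale d)
  show ?thesis
    unfolding 2 by (simp add: partial_commute_monom3[of j k])
qed

text \<open>Two differentiable functions that agree on a closed set need not have the same derivative
  at its boundary; on the cube they do, since in each coordinate direction at least one
  side stays inside.\<close>

lemma partial_eq_if_eq_on_ref_cube:
  assumes "g differentiable (at \<xi>)" "h differentiable (at \<xi>)"
    and eq: "\<And>\<zeta>. \<zeta> \<in> ref_cube \<Longrightarrow> g \<zeta> = h \<zeta>" and \<xi>: "\<xi> \<in> ref_cube"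
  shows "partial j g \<xi> = partial j h \<xi>"
proof -
  have cube: "ref_cube = cbox (- 1) (1 :: real^3)"
    by (auto simp: ref_cube_def mem_box_cart)
  have g: "(g has_derivative frechet_derivative g (at \<xi>)) (at \<xi> within cbox (- 1) 1)"
    and "(h has_derivative frechet_derivative h (at \<xi>)) (at \<xi> within cbox (- 1) 1)"
    using assms(1,2) by (auto simp: frechet_derivative_works has_derivative_at_withinI)
  then have h: "(g has_derivative frechet_derivative h (at \<xi>)) (at \<xi> within cbox (- 1) 1)"
    using \<xi> eq unfolding cube by (auto intro: has_derivative_transform)
  have "frechet_derivative g (at \<xi>) = frechet_derivative h (at \<xi>)"
    by (rule frechet_derivative_unique_within_closed_interval[OF _ _ g h])
      (use \<xi> in \<open>auto simp: cube Basis_vec_def inner_axis\<close>)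
  then show ?thesis
    by (simp add: partial_def)
qed

section \<open>Geometric conservation law\<close>

lemma divergence_curl_tensor_poly:
  assumes "\<And>i. (\<lambda>\<xi>. F \<xi> $ i) \<in> tensor_poly n"
  shows "(\<Sum>j\<in>UNIV. partial j (\<lambda>\<zeta>. curl F \<zeta> $ j) \<xi>) = 0"
proof -
  have "partial j (partial k (\<lambda>\<zeta>. F \<zeta> $ i)) \<xi> = partial k (partial j (\<lambda>\<zeta>. F \<zeta> $ i)) \<xi>" for i j k
    by (rule tensor_poly_partial_commute[OF assms])
  moreover have "partial j (\<lambda>\<zeta>. F \<zeta> $ i) differentiable (at \<xi>)" for i j
    by (rule tensor_poly_differentiable[OF tensor_poly_partial[OF assms]])
  ultimately show ?thesis
    by (simp add: curl_def sum_3 vector_3 partial_diff)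
qed

text \<open>The outer curl is applied exactly, to whatever polynomial field the interpolation returns.
  Hence interpolation errors do no harm, and the conservative and the invariant form are
  covered alike.\<close>

lemma cofactor_divergence_free:
  assumes "unisolvent (grid_degr E) (grid_nodes E)"
  shows "(\<Sum>j\<in>UNIV. partial j (\<lambda>\<zeta>. cofactor form E \<zeta> $ n $ j) \<xi>) = 0"
proof -
  define F where "F = interp_vec E (curl_integrand form (mapping E) (n + 1) (n + 2))"
  have F: "(\<lambda>\<zeta>. F \<zeta> $ i) \<in> tensor_poly (grid_degr E)" for i
    using interp_in_tensor_poly[OF assms] by (simp add: F_def interp_vec_def)
  have C: "cofactor form E \<zeta> $ n $ j = - 1 * curl F \<zeta> $ j" for \<zeta> j
    by (simp add: cofactor_def F_def)
  have "(\<lambda>\<zeta>. - 1 * cofactor form E \<zeta> $ n $ j) \<in> tensor_poly (grid_degr E)" for j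
    by (rule tensor_poly_scale[OF cofactor_in_tensor_poly[OF assms]])
  then have "(\<lambda>\<zeta>. curl F \<zeta> $ j) differentiable (at \<xi>)" for j
    unfolding C by (auto dest: tensor_poly_differentiable)
  then have "partial j (\<lambda>\<zeta>. cofactor form E \<zeta> $ n $ j) \<xi> = - 1 * partial j (\<lambda>\<zeta>. curl F \<zeta> $ j) \<xi>" for j
    unfolding C by (rule partial_scale)
  then show ?thesis
    using divergence_curl_tensor_poly[OF F, of \<xi>] by (simp add: sum_negf)
qed

section \<open>Discrete operators on expansions\<close>

lemma expand_in_tensor_poly:
  assumes "is_tensor_basis D"
  shows "expand D c \<in> tensor_poly (degr D)"
proof -
  have "(\<lambda>\<xi>. \<Sum>i\<in>UNIV. c $ i * shape D i \<xi>) \<in> tensor_poly (degr D)"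
    using assms unfolding is_tensor_basis_def by (intro tensor_poly_sum tensor_poly_scale) auto
  then show ?thesis
    by (simp add: expand_def[abs_def] mult.commute)
qed

lemma vol_mat_partial_mult_vec:
  assumes "is_tensor_basis D"
  shows "(vol_mat D (partial j) *v c) $ q = partial j (expand D c) (vnode D q)"
proof -
  have "shape D i differentiable (at \<xi>)" for i \<xi>
    using assms tensor_poly_differentiable unfolding is_tensor_basis_def by blast
  moreover have "expand D c = (\<lambda>\<xi>. \<Sum>i\<in>UNIV. c $ i * shape D i \<xi>)"
    by (simp add: expand_def[abs_def] mult.commute)
  ultimately show ?thesis
    by (simp add: partial_sum partial_scale vol_mat_def matrix_vector_mult_def mult.commute)
qed

lemma expand_sum_scale:
  "expand D (\<Sum>x\<in>A. r x *\<^sub>R c x) \<xi> = (\<Sum>x\<in>A. r x * expand D (c x) \<xi>)"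
  by (simp add: expand_def sum_distrib_left sum_component mult.left_commute) (rule sum.swap)

section \<open>The residual for constant flux\<close>

lemma phys_div_constant_flux:
  assumes "is_tensor_basis D" "invertible (ref_mass D)"
    and flux: "\<And>q. f (expand D u (vnode D q)) = \<alpha>"
  shows "phys_div D form E f u = 0"
proof -
  have const: "(\<lambda>\<xi>. \<alpha> $ i) \<in> tensor_poly (degr D)" for i
    using tensor_poly_scale[OF tensor_poly_monom3[of 0 "degr D" 0 0], of "\<alpha> $ i"]
    by (simp add: monom3_def)
  have "expand D (flux_coef D f u i) = (\<lambda>\<xi>. \<alpha> $ i)" for i
    using L2_proj_reproduces[OF assms(2,1) const] by (simp add: flux_coef_def flux)
  then have "vol_mat D (partial j) *v flux_coef D f u i = 0" for i j
    using assms(1) by (simp add: vec_eq_iff vol_mat_partial_mult_vec partial_const)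
  then show ?thesis
    by (simp add: phys_div_def)
qed

text \<open>The projection is linear, and the constant weights \<open>\<alpha> $ i\<close> move through it; this is where
  constancy of the flux is essential: a varying flux times \<open>C\<close> need not lie in the polynomial space.\<close>

lemma expand_ref_flux_coef_constant:
  assumes "metrics_reproduced D form E"
    and flux: "\<And>q. f (expand D u (vnode D q)) = \<alpha>"
    and "\<xi> \<in> ref_cube"
  shows "expand D (ref_flux_coef D form E f u j) \<xi> = (\<Sum>i\<in>UNIV. \<alpha> $ i * cofactor form E \<xi> $ i $ j)"
proof -
  define v where "v i = (\<chi> q. cofactor form E (vnode D q) $ i $ j)" for i
  have "(\<chi> q. \<Sum>i\<in>UNIV. f (expand D u (vnode D q)) $ i * cofactor form E (vnode D q) $ i $ j)
      = (\<Sum>i\<in>UNIV. \<alpha> $ i *\<^sub>R v i)"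
    by (simp add: vec_eq_iff v_def flux)
  then have "ref_flux_coef D form E f u j = (\<Sum>i\<in>UNIV. \<alpha> $ i *\<^sub>R (L2_proj D *v v i))"
    by (simp add: ref_flux_coef_def linear_sum linear_scale matrix_vector_mul_linear)
  then show ?thesis
    using assms(1,3) by (simp add: expand_sum_scale v_def metrics_reproduced_def)
qed

lemma ref_div_constant_flux:
  assumes "is_tensor_basis D" "metrics_reproduced D form E"
    and uni: "unisolvent (grid_degr E) (grid_nodes E)"
    and flux: "\<And>q. f (expand D u (vnode D q)) = \<alpha>"
    and nodes: "\<And>q. vnode D q \<in> ref_cube"
  shows "ref_div D form E f u = 0"
proof -
  have C: "(\<lambda>\<zeta>. cofactor form E \<zeta> $ i $ j) differentiable (at \<xi>)" for i j \<xi>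
    by (rule tensor_poly_differentiable[OF cofactor_in_tensor_poly[OF uni]])
  have "partial j (expand D (ref_flux_coef D form E f u j)) \<xi>
      = (\<Sum>i\<in>UNIV. \<alpha> $ i * partial j (\<lambda>\<zeta>. cofactor form E \<zeta> $ i $ j) \<xi>)"
    if "\<xi> \<in> ref_cube" for j \<xi>
  proof -
    have "partial j (expand D (ref_flux_coef D form E f u j)) \<xi>
        = partial j (\<lambda>\<zeta>. \<Sum>i\<in>UNIV. \<alpha> $ i * cofactor form E \<zeta> $ i $ j) \<xi>"
    proof (rule partial_eq_if_eq_on_ref_cube[OF _ _ _ that])
      show "expand D (ref_flux_coef D form E f u j) differentiable (at \<xi>)"
        by (rule tensor_poly_differentiable[OF expand_in_tensor_poly[OF assms(1)]])
      show "(\<lambda>\<zeta>. \<Sum>i\<in>UNIV. \<alpha> $ i * cofactor form E \<zeta> $ i $ j) differentiable (at \<xi>)"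
        using C by auto
    qed (simp add: expand_ref_flux_coef_constant assms(2) flux)
    then show ?thesis
      using C by (simp add: partial_sum partial_scale)
  qed
  then have "ref_div D form E f u $ q
      = (\<Sum>j\<in>UNIV. \<Sum>i\<in>UNIV. \<alpha> $ i * partial j (\<lambda>\<zeta>. cofactor form E \<zeta> $ i $ j) (vnode D q))" for q
    using assms(1) nodes by (simp add: ref_div_def vol_mat_partial_mult_vec)
  also have "\<dots> q
      = (\<Sum>i\<in>UNIV. \<alpha> $ i * (\<Sum>j\<in>UNIV. partial j (\<lambda>\<zeta>. cofactor form E \<zeta> $ i $ j) (vnode D q)))" for q
    unfolding sum_distrib_left by (rule sum.swap)
  finally show ?thesis
    by (simp add: vec_eq_iff cofactor_divergence_free[OF uni])
qed

lemma corr_flux_constant_flux: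
  assumes "metrics_reproduced D form E"
    and "\<And>q. f (expand D u (vnode D q)) = \<alpha>"
    and "fnode D \<phi> k \<in> ref_cube"
    and "f (expand D u (fnode D \<phi> k)) = \<alpha>" "fs \<phi> k = \<alpha>"
  shows "corr_flux D form E f u fs \<phi> k = 0"
proof -
  define C where "C = cofactor form E (fnode D \<phi> k)"
  have "(\<chi> j. expand D (ref_flux_coef D form E f u j) (fnode D \<phi> k)) = \<alpha> v* C"
    using assms(1-3)
    by (simp add: vec_eq_iff expand_ref_flux_coef_constant vector_matrix_mult_def C_def mult.commute)
  then show ?thesis
    using assms(4,5) by (simp add: corr_flux_def Let_def C_def[symmetric] flip: scaleR_add_left)
qed

theorem mainTheorem3:
  fixes D :: "('b::finite, 'q::finite, 'k::finite) reference_data"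
    and form :: curl_form
    and \<Omega> :: "(real^3) set"
    and E :: "'m::finite \<Rightarrow> element"
    and f :: "real \<Rightarrow> real^3"
    and u :: "'m \<Rightarrow> real \<Rightarrow> real^'b"
    and fs :: "'m \<Rightarrow> real \<Rightarrow> face \<Rightarrow> 'k \<Rightarrow> real^3"
    and t :: real
    and \<alpha> :: "real^3"
  assumes "reference_element D"
    and "invertible (ref_mass D)"
    and "curvilinear_mesh \<Omega> E"
    and "\<forall>m. metrics_reproduced D form (E m)"
    and "\<forall>m. sym_pos_def (norm_mat D (E m))"
    and "\<forall>m q. f (expand D (u m t) (vnode D q)) = \<alpha>"
    and "\<forall>m \<phi> k. f (expand D (u m t) (fnode D \<phi> k)) = \<alpha>"
    and "\<forall>m \<phi> k. fs m t \<phi> k = \<alpha>"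
  shows "\<forall>m.
    volume_term D form (E m) f (u m t) + surface_term D form (E m) f (u m t) (fs m t) = 0 \<and>
    (scheme_at D form (E m) f (u m) (fs m) t \<longleftrightarrow> (u m has_vector_derivative 0) (at t))"
proof (rule allI)
  fix m
  have basis: "is_tensor_basis D" and vnodes: "vnode D q \<in> ref_cube"
    and fnode_face: "fnode D \<phi> k \<in> face_set \<phi>" for q \<phi> k
    using assms(1) unfolding reference_element_def by blast+
  have fnodes: "fnode D \<phi> k \<in> ref_cube" for \<phi> k
    using fnode_face[of \<phi> k] by (simp add: face_set_def)
  have uni: "unisolvent (grid_degr (E m)) (grid_nodes (E m))"
    using assms(3) by (auto simp: curvilinear_mesh_def polynomial_element_def)
  have "ref_div D form (E m) f (u m t) = 0"
    using basis assms(4,6) uni vnodes by (intro ref_div_constant_flux) auto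
  moreover have "phys_div D form (E m) f (u m t) = 0"
    using basis assms(2,6) by (intro phys_div_constant_flux) auto
  ultimately have vol: "volume_term D form (E m) f (u m t) = 0"
    by (simp add: volume_term_def)
  have "corr_flux D form (E m) f (u m t) (fs m t) \<phi> k = 0" for \<phi> k
    using assms(4,6-8) fnodes
    by (intro corr_flux_constant_flux[where \<alpha> = \<alpha>]) (blast+)
  then have surf: "surface_term D form (E m) f (u m t) (fs m t) = 0"
    by (simp add: surface_term_def)
  show "volume_term D form (E m) f (u m t) + surface_term D form (E m) f (u m t) (fs m t) = 0 \<and>
    (scheme_at D form (E m) f (u m) (fs m) t \<longleftrightarrow> (u m has_vector_derivative 0) (at t))"
    by (auto simp: vol surf scheme_at_def)
qed

end
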